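(* Let $F=\{f_n\}_{n=1}^\infty$ be a complete sequence in an infinite dimensional Hilbert space $\mathcal{H}$ which is represented by $T$. Then there exists $m\in\mathbb{N}$ such that $\{f_{m+n}+f_{m+n+1}\}_{n=1}^\infty$ is linearly independent.
   Context: A sequence $F=\{f_n\}_{n=1}^\infty$ in $\mathcal{H}$ is represented by $T$ if $T:\operatorname{span}\{f_n\}_{n=1}^\infty\to\operatorname{span}\{f_n\}_{n=1}^\infty$ is a linear (not necessarily bounded) operator with $f_n=T(f_{n-1}+f_{n-2})$ for all $n\geqslant 3$. $F$ is complete in $\mathcal{H}$ if $\operatorname{span}\{f_n\}_{n=1}^\infty$ (finite linear combinations) is dense in $\mathcal{H}$. A sequence $\{g_n\}_{n=1}^\infty$ is linearly independent if, for every $m$, $\sum_{k=1}^m c_kg_k=0$ with scalars $c_k$ implies $c_k=0$ for all $k=1,\dots,m$. *)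

theory Defs
  imports "HOL-Analysis.Analysis"
begin

text \<open>
  Scalars are real or complex. Up to isomorphism \<open>\<real>\<close> and \<open>\<complex>\<close> are the only real normed fields
  (Gelfand-Mazur), and the axioms below then force \<open>scalar_cnj\<close> to be the identity on \<open>\<real>\<close> and complex
  conjugation on \<open>\<complex>\<close>, so the class covers exactly these two cases.
\<close>

class rc_scalar = real_normed_field +
  fixes scalar_cnj :: "'a \<Rightarrow> 'a"
  assumes scalar_cnj_mult_self: "scalar_cnj x * x = (norm x)\<^sup>2 *\<^sub>R 1"
    and scalar_cnj_zero: "scalar_cnj 0 = 0"

instantiation real :: rc_scalar
begin
definition scalar_cnj_real :: "real \<Rightarrow> real" where "scalar_cnj_real x = x"
instance by standard (simp_all add: scalar_cnj_real_def power2_eq_square)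
end

instantiation complex :: rc_scalar
begin
definition scalar_cnj_complex :: "complex \<Rightarrow> complex" where "scalar_cnj_complex = cnj"
instance by standard (simp_all add: scalar_cnj_complex_def scaleR_conv_of_real complex_norm_square mult.commute
    del: of_real_power)
end

text \<open>
  A Hilbert space is carried by a whole type. Its norm, its topology and its completeness come from
  its type classes; the scalar multiplication extends that of the underlying real space, and
  the norm is the one induced by the inner product, which is linear in its first argument.
\<close>

locale hilbert_space = vector_space scale
  for scale :: "'k::rc_scalar \<Rightarrow> 'a::{real_normed_vector,complete_space} \<Rightarrow> 'a" +
  fixes ip :: "'a \<Rightarrow> 'a \<Rightarrow> 'k"
  assumes scale_of_real: "scale (of_real r) x = r *\<^sub>R x"
    and ip_add_left: "ip (x + y) z = ip x z + ip y z"
    and ip_scale_left: "ip (scale a x) y = a * ip x y"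
    and ip_commute: "ip y x = scalar_cnj (ip x y)"
    and ip_self: "ip x x = of_real ((norm x)\<^sup>2)"
begin

definition infinite_dimensional :: bool where
  "infinite_dimensional \<longleftrightarrow> \<not> (\<exists>B. finite B \<and> span B = UNIV)"

text \<open>
  A sequence \<open>f\<^sub>1, f\<^sub>2, \<dots>\<close> is a function on \<open>nat\<close> whose value at \<open>0\<close> is disregarded.
\<close>

definition seq_span :: "(nat \<Rightarrow> 'a) \<Rightarrow> 'a set" where
  "seq_span f = span (f ` {1..})"

definition complete_seq :: "(nat \<Rightarrow> 'a) \<Rightarrow> bool" where
  "complete_seq f \<longleftrightarrow> closure (seq_span f) = UNIV"

text \<open>
  Only the values of \<open>T\<close> on the span matter; outside it \<open>T\<close> is an arbitrary total extension.
\<close>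

definition represented_by :: "(nat \<Rightarrow> 'a) \<Rightarrow> ('a \<Rightarrow> 'a) \<Rightarrow> bool" where
  "represented_by f T \<longleftrightarrow>
     T ` seq_span f \<subseteq> seq_span f \<and>
     (\<forall>x\<in>seq_span f. \<forall>y\<in>seq_span f. T (x + y) = T x + T y) \<and>
     (\<forall>a. \<forall>x\<in>seq_span f. T (scale a x) = scale a (T x)) \<and>
     (\<forall>n\<ge>3. f n = T (f (n - 1) + f (n - 2)))"

definition lin_independent_seq :: "(nat \<Rightarrow> 'a) \<Rightarrow> bool" where
  "lin_independent_seq g \<longleftrightarrow>
     (\<forall>m c. (\<Sum>k=1..m. scale (c k) (g k)) = 0 \<longrightarrow> (\<forall>k\<in>{1..m}. c k = 0))"

end

lemma hilbert_space_real:
  "hilbert_space (scaleR :: real \<Rightarrow> 'a::{real_inner,complete_space} \<Rightarrow> 'a) inner"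
  by unfold_locales
    (simp_all add: scalar_cnj_real_def inner_add_left inner_commute power2_norm_eq_inner algebra_simps)

lemma hilbert_space_complex: "hilbert_space ((*) :: complex \<Rightarrow> _) (\<lambda>x y. x * cnj y)"
  by unfold_locales
    (simp_all add: scalar_cnj_complex_def scaleR_conv_of_real complex_norm_square algebra_simps
      flip: of_real_power)

end

theory Submission
  imports Defs "HOL-Computational_Algebra.Polynomial"
begin

text \<open>
  Let \<open>h i = f\<^bsub>i+1\<^esub>\<close> and let \<open>\<Phi>\<close> be the linear map on polynomials with \<open>\<Phi> (x\<^sup>i) = h i\<close>. Then
  \<open>T (\<Phi> ((1+x) p)) = \<Phi> (x\<^sup>2 p)\<close>, so the space \<open>Q = {p. \<Phi> ((1+x) p) = 0}\<close> of relations between the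
  \<open>f\<^sub>n + f\<^bsub>n+1\<^esub>\<close> contains \<open>x\<^sup>2 r\<close> whenever it contains \<open>(1+x) r\<close>. If \<open>Q \<noteq> 0\<close>, repeating this step
  yields some \<open>b \<in> Q\<close> with \<open>b(-1) \<noteq> 0\<close>. Given \<open>q \<in> Q\<close> of degree larger than \<open>deg b\<close>, subtract a
  multiple of \<open>b\<close> to make it vanish at \<open>-1\<close>; replacing the factor \<open>1+x\<close> by \<open>x\<^sup>2\<close> gives an element
  of \<open>Q\<close> of degree \<open>deg q + 1\<close>. Hence either the degrees in \<open>Q\<close> are bounded by \<open>deg b\<close>, and any
  \<open>m > deg b\<close> works, or \<open>Q\<close> has an element in every large degree, so that the \<open>f\<^sub>n\<close> span a
  finite-dimensional space; such a space is closed, hence cannot be dense.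
\<close>

section \<open>Linear combinations as images of polynomials, and the algebra of relations\<close>

definition poly_comb :: "('a::zero \<Rightarrow> 'b \<Rightarrow> 'b) \<Rightarrow> (nat \<Rightarrow> 'b) \<Rightarrow> 'a poly \<Rightarrow> 'b::comm_monoid_add"
  where "poly_comb s h p = (\<Sum>i\<le>degree p. s (coeff p i) (h i))"

context vector_space
begin

lemma poly_comb_eq:
  assumes "degree p \<le> n"
  shows "poly_comb scale h p = (\<Sum>i\<le>n. scale (coeff p i) (h i))"
  unfolding poly_comb_def
  by (rule sum.mono_neutral_left) (use assms in \<open>auto simp: coeff_eq_0\<close>)

lemma poly_comb_0 [simp]: "poly_comb scale h 0 = 0"
  by (simp add: poly_comb_def)

lemma poly_comb_add: "poly_comb scale h (p + q) = poly_comb scale h p + poly_comb scale h q"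
proof -
  define n where "n = max (degree p) (degree q)"
  have "degree p \<le> n" "degree q \<le> n" "degree (p + q) \<le> n"
    by (auto simp: n_def degree_add_le_max)
  then show ?thesis
    by (simp add: poly_comb_eq scale_left_distrib sum.distrib)
qed

lemma poly_comb_smult: "poly_comb scale h (smult a p) = scale a (poly_comb scale h p)"
  by (simp add: poly_comb_eq[OF degree_smult_le] poly_comb_def scale_sum_right)

lemma poly_comb_diff: "poly_comb scale h (p - q) = poly_comb scale h p - poly_comb scale h q"
  using poly_comb_add[of h "p - q" q] by (simp add: algebra_simps)

lemma poly_comb_sum: "poly_comb scale h (\<Sum>k\<in>A. p k) = (\<Sum>k\<in>A. poly_comb scale h (p k))"
  by (induction A rule: infinite_finite_induct) (simp_all add: poly_comb_add)

lemma poly_comb_monom: "poly_comb scale h (monom a k) = scale a (h k)"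
proof -
  have "poly_comb scale h (monom a k) = (\<Sum>i\<le>k. if i = k then scale a (h i) else 0)"
    unfolding poly_comb_eq[OF degree_monom_le] by (rule sum.cong) (auto simp: coeff_monom)
  then show ?thesis by simp
qed

lemma poly_comb_pCons_0: "poly_comb scale h (pCons 0 p) = poly_comb scale (\<lambda>i. h (Suc i)) p"
proof -
  have "poly_comb scale h (pCons 0 p) = (\<Sum>i\<le>Suc (degree p). scale (coeff (pCons 0 p) i) (h i))"
    by (rule poly_comb_eq[OF degree_pCons_le])
  then show ?thesis
    by (simp add: sum.atMost_Suc_shift poly_comb_def del: sum.atMost_Suc)
qed

text \<open>Multiplying by \<open>1+x\<close> amounts to a change of sequence, which makes
  \<open>poly_comb\<close> of \<open>(1+x) p\<close> a combination of the sums of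
  neighbours.\<close>

lemma poly_comb_one_plus_X:
  "poly_comb scale h ([:1, 1:] * p) = poly_comb scale (\<lambda>i. h i + h (Suc i)) p"
proof -
  have "[:1, 1:] * p = p + pCons 0 p" by simp
  then show ?thesis
    by (simp add: poly_comb_add poly_comb_pCons_0)
      (simp add: poly_comb_def scale_right_distrib sum.distrib)
qed

lemma poly_comb_X_squared:
  "poly_comb scale h ([:0, 0, 1:] * p) = poly_comb scale (\<lambda>i. h (Suc (Suc i))) p"
proof -
  have "[:0, 0, 1:] * p = pCons 0 (pCons 0 p)" by simp
  then show ?thesis by (simp only: poly_comb_pCons_0)
qed

text \<open>\<open>T\<close> is linear only on the span, so the induction keeps each partial sum
  inside it.\<close>

lemma poly_comb_map:
  assumes g: "\<And>i. g i \<in> span S"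
    and add: "\<And>x y. x \<in> span S \<Longrightarrow> y \<in> span S \<Longrightarrow> T (x + y) = T x + T y"
    and scl: "\<And>a x. x \<in> span S \<Longrightarrow> T (scale a x) = scale a (T x)"
  shows "T (poly_comb scale g p) = poly_comb scale (\<lambda>i. T (g i)) p"
proof -
  have "T (\<Sum>i\<le>n. scale (coeff p i) (g i)) = (\<Sum>i\<le>n. scale (coeff p i) (T (g i)))" for n
  proof (induction n)
    case (Suc n)
    have "(\<Sum>i\<le>n. scale (coeff p i) (g i)) \<in> span S" "scale (coeff p (Suc n)) (g (Suc n)) \<in> span S"
      by (auto intro!: span_sum span_scale g)
    then show ?case by (simp add: add scl g Suc)
  qed (simp add: scl g)
  then show ?thesis by (simp add: poly_comb_def)
qed

text \<open>The leading coefficient is invertible, so the relation can be solved for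
  \<open>h n\<close>.\<close>

lemma mem_span_of_relation:
  assumes p: "degree p = n" "p \<noteq> 0" and "poly_comb scale h p = 0"
  shows "h n \<in> span (h ` {..<n})"
proof -
  have nz: "coeff p n \<noteq> 0"
    using p by auto
  have "(\<Sum>i<n. scale (coeff p i) (h i)) + scale (coeff p n) (h n) = 0"
    using assms by (simp add: poly_comb_def flip: lessThan_Suc_atMost)
  then have "scale (coeff p n) (h n) = - (\<Sum>i<n. scale (coeff p i) (h i))"
    by (simp add: eq_neg_iff_add_eq_0 add.commute)
  also have "\<dots> \<in> span (h ` {..<n})"
    by (intro span_neg span_sum span_scale span_base) auto
  finally have "scale (inverse (coeff p n)) (scale (coeff p n) (h n)) \<in> span (h ` {..<n})"
    by (rule span_scale)
  then show ?thesis using nz by simp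
qed

lemma span_range_eq_of_relations:
  fixes h :: "nat \<Rightarrow> 'b"
  assumes "\<And>n. n \<ge> N \<Longrightarrow> h n \<in> span (h ` {..<n})"
  shows "span (range h) = span (h ` {..<N})"
proof -
  have "h n \<in> span (h ` {..<N})" for n
  proof (induction n rule: less_induct)
    case (less n)
    show ?case
    proof (cases "n < N")
      case False
      have "span (h ` {..<n}) \<subseteq> span (h ` {..<N})"
        by (rule span_minimal) (use less in auto)
      then show ?thesis using assms[of n] False by auto
    qed (simp add: span_base)
  qed
  then show ?thesis
    by (intro subset_antisym span_minimal span_mono) auto
qed

lemma relation_degree_bounded_or_finite_span:
  assumes T0: "T 0 = 0"
    and T: "\<And>p. T (poly_comb scale h ([:1, 1:] * p)) = poly_comb scale h ([:0, 0, 1:] * p)"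
  shows "(\<exists>N. \<forall>p. poly_comb scale h ([:1, 1:] * p) = 0 \<longrightarrow> p \<noteq> 0 \<longrightarrow> degree p \<le> N) \<or>
         (\<exists>N. span (range h) = span (h ` {..<N}))"
proof -
  define Q where "Q = {p. poly_comb scale h ([:1, 1:] * p) = 0}"
  have step: "[:0, 0, 1:] * r \<in> Q" if "[:1, 1:] * r \<in> Q" for r
  proof -
    have "T (poly_comb scale h ([:1, 1:] * ([:1, 1:] * r))) = 0"
      using that by (simp only: Q_def mem_Collect_eq T0)
    then have "poly_comb scale h ([:0, 0, 1:] * ([:1, 1:] * r)) = 0" by (simp only: T)
    then show ?thesis by (simp only: Q_def mem_Collect_eq mult.left_commute)
  qed
  \<comment> \<open>The cofactor \<open>u\<close> varies because each round moves a new factor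
    \<open>x^2\<close> into it.\<close>
  have steps: "[:0, 0, 1:] ^ k * u \<in> Q" if "[:1, 1:] ^ k * u \<in> Q" for k u
    using that
  proof (induction k arbitrary: u)
    case (Suc k)
    then have "[:1, 1:] * ([:1, 1:] ^ k * u) \<in> Q" by (simp only: power_Suc mult.assoc)
    from step[OF this] have "[:1, 1:] ^ k * ([:0, 0, 1:] * u) \<in> Q"
      by (simp only: mult.left_commute)
    from Suc.IH[OF this] show ?case by (simp only: power_Suc mult_ac)
  qed simp
  have grow: "\<exists>r\<in>Q. degree r = Suc n"
    if b: "b \<in> Q" "poly b (-1) \<noteq> 0" and q: "q \<in> Q" "degree q = n" and n: "n > degree b" for b q n
  proof -
    define q' where "q' = q - smult (poly q (-1) / poly b (-1)) b"
    have "degree (smult (poly q (-1) / poly b (-1)) b) < degree q"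
      using n q(2) degree_smult_le[of "poly q (-1) / poly b (-1)" b] by linarith
    then have deg: "degree q' = n"
      unfolding q'_def using q(2) by (simp add: degree_add_eq_left diff_conv_add_uminus
          del: add_uminus_conv_diff)
    have "poly q' (-1) = 0" using b(2) by (simp add: q'_def)
    then obtain r where r: "q' = [:1, 1:] * r"
      by (auto simp: poly_eq_0_iff_dvd elim: dvdE)
    have "q' \<in> Q"
      using b(1) q(1)
      by (simp add: Q_def q'_def poly_comb_diff poly_comb_smult algebra_simps
          del: mult_pCons_left mult_pCons_right)
    then have "[:0, 0, 1:] * r \<in> Q" using r step by simp
    moreover have "r \<noteq> 0" using deg n r by auto
    \<comment> \<open>Dividing by \<open>1+x\<close> loses one degree and multiplying by
      \<open>x^2\<close> gains two.\<close>
    moreover from this have "degree q' = Suc (degree r)" "degree ([:0, 0, 1:] * r) = Suc (Suc (degree r))"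
      unfolding r by (subst degree_mult_eq; simp)+
    ultimately show ?thesis using deg by metis
  qed
  show ?thesis
  proof (cases "Q \<subseteq> {0}")
    case True
    then show ?thesis by (auto simp: Q_def)
  next
    case False
    then obtain a where a: "a \<in> Q" "a \<noteq> 0" by auto
    \<comment> \<open>Splitting off the full power of \<open>1+x\<close> leaves \<open>u\<close>
      nonzero at \<open>-1\<close>; since \<open>x^2\<close> has value 1 there, \<open>b\<close>
      takes the same value as \<open>u\<close>.\<close>
    from order_decomp[OF a(2), of "-1"] obtain u
      where u: "a = [:1, 1:] ^ order (-1) a * u" "\<not> [:1, 1:] dvd u" by auto
    define b where "b = [:0, 0, 1:] ^ order (-1) a * u"
    have b: "b \<in> Q" unfolding b_def by (rule steps) (use a(1) u(1) in simp)
    have "poly u (-1) \<noteq> 0" using u(2) by (simp add: poly_eq_0_iff_dvd)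
    then have b1: "poly b (-1) \<noteq> 0" by (simp add: b_def)
    show ?thesis
    proof (cases "\<exists>q\<in>Q. degree q > degree b")
      case False
      then show ?thesis by (auto simp: Q_def not_less)
    next
      case True
      then obtain q where q: "q \<in> Q" "degree q > degree b" by auto
      have all: "\<exists>r\<in>Q. degree r = n" if "n \<ge> degree q" for n
        using that
      proof (induction n rule: dec_induct)
        case (step n)
        then show ?case using grow[OF b b1] q(2) by auto
      qed (use q in auto)
      have "h n \<in> span (h ` {..<n})" if n: "n \<ge> Suc (degree q)" for n
      proof -
        have "degree q \<le> n - 1" using n by simp
        then obtain r where r: "r \<in> Q" "degree r = n - 1" using all by blast
        \<comment> \<open>The zero polynomial has degree 0, whereas \<open>n - 1\<close> is at least
          \<open>degree q\<close>, which exceeds \<open>degree b\<close>.\<close>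
        have "r \<noteq> 0" using r n q(2) by auto
        have "degree ([:1, 1:] * r) = Suc (degree r)"
          using \<open>r \<noteq> 0\<close> by (subst degree_mult_eq) auto
        then have "degree ([:1, 1:] * r) = n" using r(2) n by simp
        moreover have "[:1, 1:] * r \<noteq> 0" using \<open>r \<noteq> 0\<close> by (simp only: mult_eq_0_iff) simp
        moreover have "poly_comb scale h ([:1, 1:] * r) = 0"
          using r(1) by (simp only: Q_def mem_Collect_eq)
        ultimately show ?thesis by (rule mem_span_of_relation)
      qed
      then show ?thesis using span_range_eq_of_relations by blast
    qed
  qed
qed

end

section \<open>Orthogonal projection and closedness of finite-dimensional subspaces\<close>

context hilbert_space
begin

lemma ip_eq_0_commute: "ip x y = 0 \<Longrightarrow> ip y x = 0"
  using ip_commute[of y x] by (simp add: scalar_cnj_zero)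

lemma scalar_cnj_of_real: "scalar_cnj (of_real r :: 'k) = of_real r"
proof (cases "r = 0")
  case False
  have "scalar_cnj (of_real r :: 'k) * of_real r = of_real r * of_real r"
    by (simp add: scalar_cnj_mult_self scaleR_conv_of_real power2_eq_square)
  then show ?thesis using False by simp
qed (simp add: scalar_cnj_zero)

text \<open>Pythagoras. Products are computed in the first argument, where \<open>ip\<close> is
  additive, and then swapped, so that \<open>scalar_cnj\<close> is applied to real scalars
  only.\<close>

lemma norm_le_norm_add_orthogonal:
  assumes "ip u z = 0"
  shows "norm z \<le> norm (u + z)"
proof -
  have "ip (u + z) z = of_real ((norm z)\<^sup>2)" "ip (u + z) u = of_real ((norm u)\<^sup>2)"
    using assms ip_eq_0_commute[OF assms] by (simp_all add: ip_add_left ip_self del: of_real_power)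
  then have "ip z (u + z) = of_real ((norm z)\<^sup>2)" "ip u (u + z) = of_real ((norm u)\<^sup>2)"
    using ip_commute[of z "u + z"] ip_commute[of u "u + z"]
    by (simp_all add: scalar_cnj_of_real del: of_real_power)
  then have "ip (u + z) (u + z) = of_real ((norm u)\<^sup>2 + (norm z)\<^sup>2)"
    by (simp add: ip_add_left)
  then have "(norm (u + z))\<^sup>2 = (norm u)\<^sup>2 + (norm z)\<^sup>2"
    unfolding ip_self of_real_eq_iff .
  then have "(norm z)\<^sup>2 \<le> (norm (u + z))\<^sup>2" by simp
  then show ?thesis by (rule power2_le_imp_le) simp
qed

lemma ip_zero_left: "ip 0 y = 0"
  using ip_scale_left[of 0 0 y] by simp

lemma ip_span_eq_0:
  assumes "x \<in> span B" "\<And>y. y \<in> B \<Longrightarrow> ip y z = 0"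
  shows "ip x z = 0"
  using assms(1)
  by (induction rule: span_induct_alt) (simp_all add: ip_zero_left ip_add_left ip_scale_left assms(2))

lemma ip_diff_scale_left: "ip (x - scale a y) z = ip x z - a * ip y z"
  using ip_add_left[of "x - scale a y" "scale a y" z] by (simp add: ip_scale_left)

text \<open>A Gram-Schmidt step: \<open>z\<close> is the part of the new vector \<open>a\<close>
  orthogonal to \<open>span B\<close>, and the old projection is corrected along
  \<open>z\<close>.\<close>

lemma orthogonal_projection_exists:
  assumes "finite B"
  shows "\<exists>p\<in>span B. \<forall>y\<in>span B. ip y (x - p) = 0"
  using assms
proof (induction B arbitrary: x rule: finite_induct)
  case empty
  then show ?case by (simp add: ip_zero_left)
next
  case (insert a B)
  from insert.IH[of a] obtain pa
    where pa: "pa \<in> span B" and pa0: "\<And>y. y \<in> span B \<Longrightarrow> ip y (a - pa) = 0" by blast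
  from insert.IH[of x] obtain p
    where p: "p \<in> span B" and p0: "\<And>y. y \<in> span B \<Longrightarrow> ip y (x - p) = 0" by blast
  define z where "z = a - pa"
  \<comment> \<open>If \<open>a\<close> already lies in \<open>span B\<close>, then
    \<open>z = 0\<close>, the quotient is 0 by convention and nothing is corrected.\<close>
  define c where "c = ip (x - p) z / ip z z"
  have sub: "span B \<subseteq> span (insert a B)" by (rule span_mono) auto
  have pc: "p + scale c z \<in> span (insert a B)"
    unfolding z_def using p pa sub span_base[of a "insert a B"]
    by (intro span_add span_scale span_diff) blast+
  have B: "ip y (x - (p + scale c z)) = 0" if "y \<in> span B" for y
  proof (rule ip_eq_0_commute)
    show "ip (x - (p + scale c z)) y = 0"
      using ip_diff_scale_left[of "x - p" c z y] p0[OF that] pa0[OF that]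
      by (simp add: z_def ip_eq_0_commute diff_diff_eq)
  qed
  have "ip (x - (p + scale c z)) z = 0"
  proof (cases "z = 0")
    case True
    then show ?thesis using ip_eq_0_commute ip_zero_left by blast
  next
    case False
    then have "ip z z \<noteq> 0" by (simp add: ip_self)
    then show ?thesis
      using ip_diff_scale_left[of "x - p" c z z] by (simp add: c_def diff_diff_eq)
  qed
  then have "ip z (x - (p + scale c z)) = 0" by (rule ip_eq_0_commute)
  then have "ip a (x - (p + scale c z)) = 0"
    using ip_add_left[of z pa "x - (p + scale c z)"] B[OF pa] by (simp add: z_def)
  then have "ip y (x - (p + scale c z)) = 0" if "y \<in> span (insert a B)" for y
    using ip_span_eq_0[OF that] B span_base by blast
  then show ?case using pc by blast
qed

text \<open>By Pythagoras the residual \<open>x - p\<close> is no longer than the distance from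
  \<open>x\<close> to any point of the span, and that distance can be made arbitrarily
  small.\<close>

lemma closed_span_finite:
  assumes "finite B"
  shows "closure (span B) = span B"
proof (rule subset_antisym[OF _ closure_subset], rule subsetI)
  fix x assume x: "x \<in> closure (span B)"
  from orthogonal_projection_exists[OF assms, of x] obtain p
    where p: "p \<in> span B" and p0: "\<And>y. y \<in> span B \<Longrightarrow> ip y (x - p) = 0" by blast
  have "norm (x - p) < e" if e: "e > 0" for e
  proof -
    obtain y where y: "y \<in> span B" "dist y x < e"
      using x e by (auto simp: closure_approachable)
    have "norm (x - p) \<le> norm ((p - y) + (x - p))"
      using p y(1) by (intro norm_le_norm_add_orthogonal p0 span_diff)
    also have "\<dots> < e" using y(2) by (simp add: dist_norm norm_minus_commute)
    finally show ?thesis .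
  qed
  then have "norm (x - p) = 0" by (metis less_irrefl zero_less_norm_iff norm_eq_zero)
  then show "x \<in> span B" using p by simp
qed

lemma lin_independent_seq_of_degree_bound:
  assumes "m \<ge> 1"
    and bound: "\<And>p. poly_comb scale (\<lambda>i. f (Suc i)) ([:1, 1:] * p) = 0 \<Longrightarrow> p \<noteq> 0 \<Longrightarrow> degree p < m"
  shows "lin_independent_seq (\<lambda>n. f (m + n) + f (m + n + 1))"
  unfolding lin_independent_seq_def
proof (intro allI impI ballI)
  fix M c k
  assume sum0: "(\<Sum>k=1..M. scale (c k) (f (m + k) + f (m + k + 1))) = 0" and k: "k \<in> {1..M}"
  \<comment> \<open>The exponent is \<open>m + k - 1\<close> because \<open>x^i\<close> stands for
    \<open>f (Suc i)\<close>.\<close>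
  define p where "p = (\<Sum>k=1..M. monom (c k) (m + k - 1))"
  have "poly_comb scale (\<lambda>i. f (Suc i)) ([:1, 1:] * p) = 0"
    unfolding poly_comb_one_plus_X p_def poly_comb_sum poly_comb_monom
    using sum0 \<open>m \<ge> 1\<close> by simp
  moreover have coeff: "coeff p (m + k - 1) = c k"
  proof -
    have "coeff p (m + k - 1) = (\<Sum>j=1..M. if j = k then c j else 0)"
      unfolding p_def coeff_sum
      by (rule sum.cong) (use \<open>m \<ge> 1\<close> in \<open>auto simp: coeff_monom\<close>)
    then show ?thesis using k by simp
  qed
  \<comment> \<open>Since \<open>k\<close> is at least 1, a nonzero \<open>c k\<close> would give
    \<open>p\<close> degree at least \<open>m\<close>, against \<open>bound\<close>.\<close>
  ultimately show "c k = 0"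
    using bound[of p] k le_degree[of p "m + k - 1"] by fastforce
qed

end

theorem theorem3p16:
  fixes scale :: "'k::rc_scalar \<Rightarrow> 'a::{real_normed_vector,complete_space} \<Rightarrow> 'a"
    and ip :: "'a \<Rightarrow> 'a \<Rightarrow> 'k"
    and f :: "nat \<Rightarrow> 'a"
    and T :: "'a \<Rightarrow> 'a"
  assumes "hilbert_space scale ip"
    and "hilbert_space.infinite_dimensional scale"
    and "hilbert_space.complete_seq scale f"
    and "hilbert_space.represented_by scale f T"
  shows "\<exists>m\<ge>1. hilbert_space.lin_independent_seq scale (\<lambda>n. f (m + n) + f (m + n + 1))"
proof -
  interpret hilbert_space scale ip by (fact assms(1))
  \<comment> \<open>The shift aligns exponents, which start at 0, with the sequence, which starts at
    \<open>f 1\<close>.\<close>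
  define h where "h = (\<lambda>i. f (Suc i))"
  have "f ` {1..} = range h"
    unfolding h_def by (auto simp: image_iff) (metis Suc_pred' Suc_le_eq One_nat_def)
  then have V: "seq_span f = span (range h)" by (simp add: seq_span_def)
  have add: "T (x + y) = T x + T y" if "x \<in> span (range h)" "y \<in> span (range h)" for x y
    using assms(4) that by (auto simp: represented_by_def V)
  have scl: "T (scale a x) = scale a (T x)" if "x \<in> span (range h)" for a x
    using assms(4) that by (auto simp: represented_by_def V)
  have rec: "T (h i + h (Suc i)) = h (Suc (Suc i))" for i
  proof -
    have "f (i + 3) = T (f (i + 3 - 1) + f (i + 3 - 2))"
      using assms(4) unfolding represented_by_def by (metis le_add2)
    then show ?thesis by (simp add: h_def add.commute eval_nat_numeral)
  qed
  have T0: "T 0 = 0"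
    using scl[of 0 0] by (simp add: span_zero)
  have "T (poly_comb scale h ([:1, 1:] * p)) = poly_comb scale h ([:0, 0, 1:] * p)" for p
  proof -
    have "T (poly_comb scale (\<lambda>i. h i + h (Suc i)) p) = poly_comb scale (\<lambda>i. T (h i + h (Suc i))) p"
      by (rule poly_comb_map[where S = "range h"]) (auto intro: span_add span_base add scl)
    then show ?thesis by (simp only: poly_comb_one_plus_X poly_comb_X_squared rec)
  qed
  from relation_degree_bounded_or_finite_span[of T h, OF T0 this] show ?thesis
  proof (elim disjE exE)
    fix N assume "\<forall>p. poly_comb scale h ([:1, 1:] * p) = 0 \<longrightarrow> p \<noteq> 0 \<longrightarrow> degree p \<le> N"
    then have "lin_independent_seq (\<lambda>n. f (Suc N + n) + f (Suc N + n + 1))"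
      unfolding h_def by (intro lin_independent_seq_of_degree_bound) (auto simp: less_Suc_eq_le)
    then show ?thesis by (intro exI[of _ "Suc N"]) simp
  next
    fix N assume "span (range h) = span (h ` {..<N})"
    \<comment> \<open>This span is dense by completeness of \<open>f\<close> and closed because it
      is finitely generated.\<close>
    then have "span (h ` {..<N}) = UNIV"
      using assms(3) closed_span_finite[of "h ` {..<N}"] by (simp add: complete_seq_def V)
    then have False
      using assms(2) unfolding infinite_dimensional_def by blast
    then show ?thesis ..
  qed
qed

end
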